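(* Define, for real $x$, $$a(x)=\frac{8}{\pi}\left(\frac{\pi}{2}-x\right)+\left(\frac{16}{\pi^{2}}-\frac{8}{3}\right)\left(\frac{\pi}{2}-x\right)^{2}$$ and $$b(x)=a(x)+\left(\frac{32}{\pi^{3}}-\frac{8}{3\pi}\right)\left(\frac{\pi}{2}-x\right)^{3}.$$ Then: (i) for every real $x\in\left(0.373,\frac{\pi}{2}\right)$, $$\frac{8+a(x)}{\pi^{2}-4x^{2}}<\frac{\tan x}{x};$$ (ii) for every real $x\in\left(0.301,\frac{\pi}{2}\right)$, $$\frac{\tan x}{x}<\frac{8+b(x)}{\pi^{2}-4x^{2}}.$$
   Context: The numbers $0.373$ and $0.301$ are exact decimal constants. *)

theory Defs
  imports Complex_Main
begin

definition a :: "real \<Rightarrow> real" where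
  "a x = 8 / pi * (pi / 2 - x) + (16 / pi\<^sup>2 - 8 / 3) * (pi / 2 - x)\<^sup>2"

definition b :: "real \<Rightarrow> real" where
  "b x = a x + (32 / pi ^ 3 - 8 / (3 * pi)) * (pi / 2 - x) ^ 3"

end

theory Submission
  imports Defs "HOL-Analysis.Complex_Transcendental"
begin

text \<open>
  With t = pi/2 - x the quotient tan x / x becomes cos t / (sin t * x), and
  pi^2 - 4 x^2 = 4 t (pi - t). The coefficients of a are chosen such that
  (8 + a x) * x and 4 (pi - t) * (t cot t) have the same Taylor expansion at t = 0 up to
  order 2 (up to order 3 for b). Hence it suffices to bound t cot t on both sides by
  1 - t^2/3 - t^4/45 - K t^6 with K slightly above or below the true
  coefficient 2/945, and to compare polynomials in t.
\<close>

text \<open>Cutting the series before degree 5 leaves an error of at most x^5/5!, which equals the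
  next Taylor term; one side of the absolute-value estimate is then the claim. The three Taylor
  bounds below use the same device.\<close>

lemma sin_le_taylor5:
  fixes x :: real
  assumes "0 \<le> x"
  shows "sin x \<le> x - x ^ 3 / 6 + x ^ 5 / 120"
  using Maclaurin_sin_bound[of x 5] assms
  by (simp add: lessThan_nat_numeral lessThan_Suc sin_coeff_def fact_numeral abs_if split: if_splits)

lemma sin_ge_taylor7:
  fixes x :: real
  assumes "0 \<le> x"
  shows "x - x ^ 3 / 6 + x ^ 5 / 120 - x ^ 7 / 5040 \<le> sin x"
  using Maclaurin_sin_bound[of x 7] assms
  by (simp add: lessThan_nat_numeral lessThan_Suc sin_coeff_def fact_numeral abs_if split: if_splits)

text \<open>Each derivative of cos is a shifted cosine, so the Lagrange remainder is at most x^n/n!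
  in absolute value. This is the cosine counterpart of \<open>Maclaurin_sin_bound\<close>.\<close>

lemma Maclaurin_cos_bound:
  fixes x :: real
  assumes "0 < x" "0 < n"
  shows "\<bar>cos x - (\<Sum>m<n. cos_coeff m * x ^ m)\<bar> \<le> x ^ n / fact n"
proof -
  obtain t where "cos x = (\<Sum>m<n. cos_coeff m * x ^ m) + cos (t + 1/2 * real n * pi) / fact n * x ^ n"
    using Maclaurin_cos_expansion2[OF assms] by blast
  then have "\<bar>cos x - (\<Sum>m<n. cos_coeff m * x ^ m)\<bar> = \<bar>cos (t + 1/2 * real n * pi)\<bar> * (x ^ n / fact n)"
    using assms by (simp add: abs_mult)
  also have "\<dots> \<le> 1 * (x ^ n / fact n)"
    using assms by (intro mult_right_mono) auto
  finally show ?thesis by simp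
qed

lemma cos_ge_taylor6:
  fixes x :: real
  assumes "0 < x"
  shows "1 - x ^ 2 / 2 + x ^ 4 / 24 - x ^ 6 / 720 \<le> cos x"
  using Maclaurin_cos_bound[of x 6] assms
  by (simp add: lessThan_nat_numeral lessThan_Suc cos_coeff_def fact_numeral abs_if split: if_splits)

lemma cos_le_taylor8:
  fixes x :: real
  assumes "0 < x"
  shows "cos x \<le> 1 - x ^ 2 / 2 + x ^ 4 / 24 - x ^ 6 / 720 + x ^ 8 / 40320"
  using Maclaurin_cos_bound[of x 8] assms
  by (simp add: lessThan_nat_numeral lessThan_Suc cos_coeff_def fact_numeral abs_if split: if_splits)

text \<open>Lower bound for t cot t, with K = 1/250. Bounding sin above and cos below by Taylor
  polynomials and dividing by t leaves a polynomial inequality in u = t^2.\<close>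

lemma mult_cos_ge:
  fixes t :: real
  assumes "0 < t" "t \<le> 6 / 5"
  shows "sin t * (1 - t ^ 2 / 3 - t ^ 4 / 45 - t ^ 6 / 250) \<le> t * cos t"
proof -
  define u where "u = t ^ 2"
  have u: "0 \<le> u" "u \<le> 36 / 25"
    using power_mono[of t "6/5" 2] assms by (auto simp: u_def power2_eq_square)
  have u2: "u ^ 2 \<le> (36 / 25) ^ 2" and u3: "u ^ 3 \<le> (36 / 25) ^ 3"
    using u by (auto intro: power_mono)
  \<comment> \<open>The sign of this factor allows the Taylor bound for sin to be multiplied by
    it.\<close>
  have Q: "0 \<le> 1 - u / 3 - u ^ 2 / 45 - u ^ 3 / 250"
    using u u2 u3 by (simp add: power_divide)
  have poly: "(1 - u / 6 + u ^ 2 / 120) * (1 - u / 3 - u ^ 2 / 45 - u ^ 3 / 250)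
      \<le> 1 - u / 2 + u ^ 2 / 24 - u ^ 3 / 720"
  proof -
    \<comment> \<open>Below u^3 everything cancels, since the factor carries the first coefficients
      of t cot t. With sin cut at degree 5, a positive u^3 coefficient requires K > 1/432, which is
      stronger than K > 2/945; K = 1/250 also leaves room for the negative linear term.\<close>
    have "(1 - u / 2 + u ^ 2 / 24 - u ^ 3 / 720)
        - (1 - u / 6 + u ^ 2 / 120) * (1 - u / 3 - u ^ 2 / 45 - u ^ 3 / 250)
        = u ^ 3 * ((1/250 - 1/720 + 1/360 - 1/270) - u * (1/1500 - 1/5400) + u ^ 2 / 30000)"
      by (simp add: field_simps eval_nat_numeral)
    also have "\<dots> \<ge> 0"
      using u by (intro mult_nonneg_nonneg add_nonneg_nonneg) auto
    finally show ?thesis by simp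
  qed
  have "sin t \<le> t * (1 - u / 6 + u ^ 2 / 120)"
    using sin_le_taylor5[of t] assms by (simp add: u_def field_simps eval_nat_numeral)
  from mult_right_mono[OF this Q]
  have "sin t * (1 - u / 3 - u ^ 2 / 45 - u ^ 3 / 250)
      \<le> t * ((1 - u / 6 + u ^ 2 / 120) * (1 - u / 3 - u ^ 2 / 45 - u ^ 3 / 250))"
    by (simp only: mult.assoc)
  also have "\<dots> \<le> t * (1 - u / 2 + u ^ 2 / 24 - u ^ 3 / 720)"
    using poly assms by (intro mult_left_mono) auto
  also have "\<dots> \<le> t * cos t"
    using cos_ge_taylor6[of t] assms by (intro mult_left_mono) (auto simp: u_def power_mult[symmetric])
  finally show ?thesis by (simp add: u_def power_mult[symmetric])
qed

lemma mult_cos_le: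
  fixes t :: real
  assumes "0 < t" "t \<le> 127 / 100"
  shows "t * cos t \<le> sin t * (1 - t ^ 2 / 3 - t ^ 4 / 45 - 9 * t ^ 6 / 5000)"
proof -
  define u where "u = t ^ 2"
  have u: "0 \<le> u" "u \<le> 17 / 10"
    using power_mono[of t "127/100" 2] assms by (auto simp: u_def power2_eq_square)
  have u2: "u ^ 2 \<le> (17 / 10) ^ 2" and u3: "u ^ 3 \<le> (17 / 10) ^ 3"
    using u by (auto intro: power_mono)
  have Q: "0 \<le> 1 - u / 3 - u ^ 2 / 45 - 9 * u ^ 3 / 5000"
    using u u2 u3 by (simp add: power_divide)
  have poly: "1 - u / 2 + u ^ 2 / 24 - u ^ 3 / 720 + u ^ 4 / 40320
      \<le> (1 - u / 6 + u ^ 2 / 120 - u ^ 3 / 5040) * (1 - u / 3 - u ^ 2 / 45 - 9 * u ^ 3 / 5000)"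
  proof -
    \<comment> \<open>Both series now reach far enough for the u^3 coefficient to be exactly 2/945 -
      K, with K = 9/5000.\<close>
    have "(1 - u / 6 + u ^ 2 / 120 - u ^ 3 / 5040) * (1 - u / 3 - u ^ 2 / 45 - 9 * u ^ 3 / 5000)
        - (1 - u / 2 + u ^ 2 / 24 - u ^ 3 / 720 + u ^ 4 / 40320)
        = u ^ 3 * ((2/945 - 9/5000) + u * (3/10000 - 1/5400 + 1/15120 - 1/40320)
            - u ^ 2 * (3/200000 - 1/226800) + u ^ 3 / 2800000)"
      by (simp add: field_simps eval_nat_numeral)
    also have "\<dots> \<ge> 0"
    proof (intro mult_nonneg_nonneg add_nonneg_nonneg)
      show "0 \<le> 2/945 - 9/5000 + u * (3/10000 - 1/5400 + 1/15120 - 1/40320)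
            - u ^ 2 * (3/200000 - 1/226800)"
        using u u2 by (simp add: power_divide)
    qed (use u in auto)
    finally show ?thesis by simp
  qed
  have "t * cos t \<le> t * (1 - u / 2 + u ^ 2 / 24 - u ^ 3 / 720 + u ^ 4 / 40320)"
    using cos_le_taylor8[of t] assms by (intro mult_left_mono) (auto simp: u_def power_mult[symmetric])
  also have "\<dots> \<le> t * ((1 - u / 6 + u ^ 2 / 120 - u ^ 3 / 5040) *
                     (1 - u / 3 - u ^ 2 / 45 - 9 * u ^ 3 / 5000))"
    using poly assms by (intro mult_left_mono) auto
  also have "\<dots> \<le> sin t * (1 - u / 3 - u ^ 2 / 45 - 9 * u ^ 3 / 5000)"
  proof -
    have "t * (1 - u / 6 + u ^ 2 / 120 - u ^ 3 / 5040) \<le> sin t"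
      using sin_ge_taylor7[of t] assms by (simp add: u_def field_simps eval_nat_numeral)
    from mult_right_mono[OF this Q] show ?thesis by (simp only: mult.assoc)
  qed
  finally show ?thesis by (simp add: u_def power_mult[symmetric])
qed

lemma tan_div_conv:
  fixes t :: real
  shows "tan (pi / 2 - t) / (pi / 2 - t) = cos t / (sin t * (pi / 2 - t))"
  by (simp add: tan_def sin_diff cos_diff)

lemma pi_sq_minus: "pi\<^sup>2 - 4 * (pi / 2 - t)\<^sup>2 = 4 * t * (pi - t)"
  by (simp add: field_simps power2_eq_square)

lemma a_reflect:
  "(8 + a (pi / 2 - t)) * (pi / 2 - t)
     = 4 * pi - 4 * t - 4 * pi / 3 * t ^ 2 - (16 / pi ^ 2 - 8 / 3) * t ^ 3"
  by (simp add: a_def field_simps eval_nat_numeral)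

text \<open>The cubic term of b changes the t^3 coefficient to 4/3, the one in 4 (pi - t) (1 -
  t^2/3). For a it falls short of 4/3 by 16/pi^2 - 4/3, which is the quantity that drives the lower
  bound.\<close>

lemma b_reflect:
  "(8 + b (pi / 2 - t)) * (pi / 2 - t)
     = 4 * pi - 4 * t - 4 * pi / 3 * t ^ 2 + 4 / 3 * t ^ 3 - (32 / pi ^ 3 - 8 / (3 * pi)) * t ^ 4"
proof -
  define d where "d = 32 / pi ^ 3 - 8 / (3 * pi)"
  have "(8 + b (pi / 2 - t)) * (pi / 2 - t) = (8 + a (pi / 2 - t)) * (pi / 2 - t)
      + d * pi / 2 * t ^ 3 - d * t ^ 4"
    unfolding b_def d_def[symmetric] by (simp add: algebra_simps eval_nat_numeral)
  also have "d * pi / 2 = 16 / pi ^ 2 - 4 / 3"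
    by (simp add: d_def field_simps eval_nat_numeral)
  finally show ?thesis
    unfolding a_reflect d_def[symmetric] by (simp add: algebra_simps)
qed

lemma tan_div_reflect_gt:
  fixes t :: real
  assumes "0 < t" "t \<le> 6 / 5"
  shows "(8 + a (pi / 2 - t)) / (pi\<^sup>2 - 4 * (pi / 2 - t)\<^sup>2) < tan (pi / 2 - t) / (pi / 2 - t)"
proof -
  have t: "t < pi / 2" using assms pi_approx by simp
  have s: "0 < sin t" using assms t by (intro sin_gt_zero) auto
  have "pi ^ 2 < (3142 / 1000) ^ 2"
    using pi_approx by (intro power_strict_mono) auto
  then have p: "16 / pi ^ 2 > 162 / 100"
    by (simp add: field_simps power_divide)
  \<comment> \<open>This is the polynomial comparison with \<open>a_reflect\<close> after cancelling
    t^3.\<close>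
  have "4 * (pi - t) * t * (1 / 45 + t ^ 2 / 250) < 16 / pi ^ 2 - 4 / 3"
  proof -
    have "t ^ 2 \<le> (6 / 5) ^ 2" using assms by (intro power_mono) auto
    then have 1: "1 / 45 + t ^ 2 / 250 \<le> 285 / 10000" by (simp add: power_divide)
    \<comment> \<open>The product is the value of (pi - t) t at 6/5 minus its value at t, so the
      maximum on the range is at 6/5.\<close>
    have "0 \<le> (6 / 5 - t) * (pi - t - 6 / 5)"
      using assms pi_approx by (intro mult_nonneg_nonneg) auto
    then have "(pi - t) * t \<le> 6 / 5 * (pi - 6 / 5)"
      by (simp add: algebra_simps)
    also have "\<dots> \<le> 234 / 100" using pi_approx by simp
    finally have 2: "4 * (pi - t) * t \<le> 936 / 100" by linarith
    have "4 * (pi - t) * t * (1 / 45 + t ^ 2 / 250) \<le> 936 / 100 * (285 / 10000)"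
      using assms t by (intro mult_mono 1 2) auto
    also have "\<dots> < 16 / pi ^ 2 - 4 / 3" using p by simp
    finally show ?thesis .
  qed
  then have "0 < t ^ 3 * (16 / pi ^ 2 - 4 / 3 - 4 * (pi - t) * t * (1 / 45 + t ^ 2 / 250))"
    using assms by simp
  also have "\<dots> = 4 * (pi - t) * (1 - t ^ 2 / 3 - t ^ 4 / 45 - t ^ 6 / 250)
      - (8 + a (pi / 2 - t)) * (pi / 2 - t)"
    unfolding a_reflect
    by (simp add: algebra_simps add_divide_distrib diff_divide_distrib eval_nat_numeral)
  finally have "sin t * ((8 + a (pi / 2 - t)) * (pi / 2 - t))
      < sin t * (4 * (pi - t) * (1 - t ^ 2 / 3 - t ^ 4 / 45 - t ^ 6 / 250))"
    using s by simp
  also have "\<dots> \<le> 4 * (pi - t) * (t * cos t)"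
    using mult_left_mono[OF mult_cos_ge[OF assms], of "4 * (pi - t)"] t assms
    by (simp add: mult_ac)
  finally show ?thesis
    unfolding tan_div_conv pi_sq_minus using s t assms by (simp add: divide_simps mult_ac)
qed

lemma tan_div_reflect_lt:
  fixes t :: real
  assumes "0 < t" "t \<le> 127 / 100"
  shows "tan (pi / 2 - t) / (pi / 2 - t) < (8 + b (pi / 2 - t)) / (pi\<^sup>2 - 4 * (pi / 2 - t)\<^sup>2)"
proof -
  have t: "t < pi / 2" using assms pi_approx by simp
  have s: "0 < sin t" using assms t by (intro sin_gt_zero) auto
  have "(31415 / 10000) ^ 3 < pi ^ 3"
    using pi_approx by (intro power_strict_mono) auto
  then have "32 / pi ^ 3 < 10323 / 10000"
    by (simp add: field_simps power_divide)
  moreover have "8 / (3 * pi) > 8487 / 10000"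
    using pi_approx by (simp add: field_simps)
  ultimately have p: "32 / pi ^ 3 - 8 / (3 * pi) < 184 / 1000" by simp
  \<comment> \<open>Comparison with \<open>b_reflect\<close> after cancelling t^4. The margin is
    small: the right side is about 0.188 at t = 127/100.\<close>
  have "184 / 1000 < 4 * (pi - t) * (1 / 45 + 9 * t ^ 2 / 5000)"
  proof -
    \<comment> \<open>Replacing t^2 by (roughly) its tangent at 6/5 leaves a concave quadratic,
      which is controlled by its values at the endpoints.\<close>
    have "0 \<le> (t - 6 / 5) ^ 2" by simp
    then have 1: "196 / 10000 + 43 / 10000 * t \<le> 1 / 45 + 9 * t ^ 2 / 5000"
      using assms by (simp add: power2_eq_square algebra_simps)
    have "t * t \<le> 127 / 100 * t" using assms by (intro mult_right_mono) auto
    then have "184 / 1000 < 153909 / 625000 - 60937 / 2500000 * t - 43 / 2500 * (t * t)"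
      using assms by linarith
    also have "\<dots> = 4 * (3141 / 1000 - t) * (196 / 10000 + 43 / 10000 * t)"
      by (simp add: field_simps)
    also have "\<dots> \<le> 4 * (pi - t) * (1 / 45 + 9 * t ^ 2 / 5000)"
      using pi_approx assms by (intro mult_mono 1) auto
    finally show ?thesis .
  qed
  then have "0 < t ^ 4 * (4 * (pi - t) * (1 / 45 + 9 * t ^ 2 / 5000) - (32 / pi ^ 3 - 8 / (3 * pi)))"
    using assms p by simp
  also have "\<dots> = (8 + b (pi / 2 - t)) * (pi / 2 - t)
      - 4 * (pi - t) * (1 - t ^ 2 / 3 - t ^ 4 / 45 - 9 * t ^ 6 / 5000)"
    unfolding b_reflect
    by (simp add: algebra_simps add_divide_distrib diff_divide_distrib eval_nat_numeral)
  finally have *: "sin t * (4 * (pi - t) * (1 - t ^ 2 / 3 - t ^ 4 / 45 - 9 * t ^ 6 / 5000))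
      < sin t * ((8 + b (pi / 2 - t)) * (pi / 2 - t))"
    using s by simp
  have "4 * (pi - t) * (t * cos t)
      \<le> sin t * (4 * (pi - t) * (1 - t ^ 2 / 3 - t ^ 4 / 45 - 9 * t ^ 6 / 5000))"
    using mult_left_mono[OF mult_cos_le[OF assms], of "4 * (pi - t)"] t assms
    by (simp add: mult_ac)
  also note *
  finally show ?thesis
    unfolding tan_div_conv pi_sq_minus using s t assms by (simp add: divide_simps mult_ac)
qed

theorem theorem1:
  shows "(\<forall>x::real. x \<in> {0.373<..<pi / 2} \<longrightarrow>
            (8 + a x) / (pi\<^sup>2 - 4 * x\<^sup>2) < tan x / x)
       \<and> (\<forall>x::real. x \<in> {0.301<..<pi / 2} \<longrightarrow>
            tan x / x < (8 + b x) / (pi\<^sup>2 - 4 * x\<^sup>2))"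
proof (intro conjI allI impI)
  fix x :: real
  assume "x \<in> {0.373<..<pi / 2}"
  then show "(8 + a x) / (pi\<^sup>2 - 4 * x\<^sup>2) < tan x / x"
    \<comment> \<open>The endpoint 0.373 gives t < pi/2 - 0.373, just below 6/5; likewise pi/2 -
      0.301 is just below 127/100 in the second part.\<close>
    using tan_div_reflect_gt[of "pi / 2 - x"] pi_approx by simp
next
  fix x :: real
  assume "x \<in> {0.301<..<pi / 2}"
  then show "tan x / x < (8 + b x) / (pi\<^sup>2 - 4 * x\<^sup>2)"
    using tan_div_reflect_lt[of "pi / 2 - x"] pi_approx by simp
qed

end
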